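(* Let $g$ be any symmetric function. If $a_\lambda$ and $b_S$ are constants such that $$g=\sum_\lambda a_\lambda\,\tilde\Xi_\lambda\qquad\text{and}\qquad g=\sum_S b_S\,Q_S,$$ then for every integer partition $\lambda$ $$a_\lambda=\sum_{\{S\,\mid\,\mathrm{type}(S)=\lambda\}}b_S.$$
   Context: Symmetric functions are in countably many variables $x=(x_1,x_2,\dots)$, with rational coefficients. For a positive integer $d$ and a subset $S\subset[d-1]=\{1,\dots,d-1\}$, the fundamental quasi-symmetric function is $$Q_S=Q_{S,d}(x)=\sum_{\substack{i_1\le\cdots\le i_d\\ i_j<i_{j+1}\text{ if }j\in S}}x_{i_1}x_{i_2}\cdots x_{i_d}.$$ The degree $d$ is suppressed in the notation $Q_S$ and $b_S$: for $g$ homogeneous of degree $d$, $\lambda$ ranges over partitions of $d$ and $S$ over subsets of $[d-1]$ (in general one works in each degree $d$ separately). The type of $S\subset[d-1]$ is the integer partition of $d$ whose parts are the lengths of the subwords obtained by breaking the word $123\ldots d$ after each element of $S$. For an integer partition $\lambda$, $\tilde m_\lambda=(r_1!r_2!\cdots)m_\lambda$ where $r_i$ is the number of parts of $\lambda$ equal to $i$. $D_\lambda$ is the digraph which is a disjoint union of directed paths, the $i$th having $\lambda_i$ vertices. Every subset $F$ of the edges of $D_\lambda$ gives a spanning subgraph that is a disjoint union of directed paths (isolated vertices being paths with no edges); let $\pi(F)$ be the partition of the vertex set into the vertex sets of these paths and $\ell(\pi(F))$ their number. Then $$\tilde\Xi_\lambda=\sum_{F\subset E(D_\lambda)}\frac{\tilde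 m_{\pi(F)}}{\ell(\pi(F))!},$$ where a set partition in a subscript stands for the integer partition of its block sizes. The $\tilde\Xi_\lambda$ form a $\mathbb Q$-linear basis of the ring of symmetric functions. *)

theory Defs
  imports Complex_Main "HOL-Library.Multiset"
begin

text \<open>
  A formal power series over the rationals in variables \<open>x\<^sub>0, x\<^sub>1, \<dots>\<close> is given by its coefficients:
  the monomial \<open>x\<^sub>i\<^sub>1 \<cdots> x\<^sub>i\<^sub>d\<close> is the multiset \<open>{#i\<^sub>1, \<dots>, i\<^sub>d#}\<close> of its variable indices (so its
  degree is the size of the multiset). Indexing the variables from 0 instead of 1 is immaterial,
  only the order of the indices is used.
\<close>

type_synonym series = "nat multiset \<Rightarrow> rat"

definition symmetric_function :: "series \<Rightarrow> bool" where
  "symmetric_function g \<longleftrightarrow>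
     (\<exists>n. \<forall>M. g M \<noteq> 0 \<longrightarrow> size M \<le> n) \<and>
     (\<forall>p M. bij p \<longrightarrow> g (image_mset p M) = g M)"

definition integer_partition :: "nat list \<Rightarrow> bool" where
  "integer_partition l \<longleftrightarrow> sorted_wrt (\<ge>) l \<and> (\<forall>k\<in>set l. 0 < k)"

definition partition_of_mset :: "nat multiset \<Rightarrow> nat list" where
  "partition_of_mset A = rev (sorted_list_of_multiset A)"

text \<open>
  The coefficient of a monomial is the number of index sequences \<open>i\<^sub>1 \<le> \<cdots> \<le> i\<^sub>d\<close> contributing it.
  List positions start at 0, so \<open>i\<^sub>j\<close> is \<open>is ! (j - 1)\<close>. The definition is meant for
  \<open>S \<subseteq> {1..<d}\<close>; for \<open>d = 0\<close> it gives the constant series 1.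
\<close>

definition fundamental_qsym :: "nat \<Rightarrow> nat set \<Rightarrow> series" where
  "fundamental_qsym d S = (\<lambda>M. of_nat (card {is. length is = d \<and> sorted is \<and>
      (\<forall>j\<in>S. is ! (j - 1) < is ! j) \<and> mset is = M}))"

fun break_after :: "'a set \<Rightarrow> 'a list \<Rightarrow> 'a list list" where
  "break_after S [] = []"
| "break_after S [x] = [[x]]"
| "break_after S (x # y # xs) =
     (if x \<in> S then [x] # break_after S (y # xs)
      else (x # hd (break_after S (y # xs))) # tl (break_after S (y # xs)))"

definition set_type :: "nat \<Rightarrow> nat set \<Rightarrow> nat list" where
  "set_type d S = partition_of_mset (mset (map length (break_after S [1..<Suc d])))"

definition exponents :: "nat multiset \<Rightarrow> nat multiset" where
  "exponents M = image_mset (count M) (mset_set (set_mset M))"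

definition monomial_sym :: "nat list \<Rightarrow> series" where
  "monomial_sym l = (\<lambda>M. if exponents M = mset l then 1 else 0)"

definition aug_monomial_sym :: "nat list \<Rightarrow> series" where
  "aug_monomial_sym l = (\<lambda>M. (\<Prod>i\<in>set l. fact (count_list l i)) * monomial_sym l M)"

text \<open>Vertex \<open>(i, j)\<close> is the \<open>j\<close>-th vertex of the \<open>i\<close>-th path, both counted from 0.\<close>

definition path_verts :: "nat list \<Rightarrow> (nat \<times> nat) set" where
  "path_verts l = {(i, j). i < length l \<and> j < l ! i}"

definition path_edges :: "nat list \<Rightarrow> ((nat \<times> nat) \<times> (nat \<times> nat)) set" where
  "path_edges l = {((i, j), (i, Suc j)) | i j. i < length l \<and> Suc j < l ! i}"

text \<open>
  The vertex sets of the paths of the spanning subgraph with vertices \<open>V\<close> and edges \<open>F\<close> are its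
  weakly connected components.
\<close>

definition components :: "'v set \<Rightarrow> ('v \<times> 'v) set \<Rightarrow> 'v set set" where
  "components V F = V // ((F \<union> F\<inverse>)\<^sup>* \<inter> V \<times> V)"

definition block_sizes :: "'v set set \<Rightarrow> nat list" where
  "block_sizes P = partition_of_mset (image_mset card (mset_set P))"

definition Xi_tilde :: "nat list \<Rightarrow> series" where
  "Xi_tilde l = (\<lambda>M. \<Sum>F\<in>Pow (path_edges l).
      aug_monomial_sym (block_sizes (components (path_verts l) F)) M /
      fact (card (components (path_verts l) F)))"

end

theory Submission
  imports Defs "HOL-Combinatorics.Multiset_Permutations" "HOL-Combinatorics.Permutations"
begin

text \<open>
  Consider the linear operator that replaces the coefficient of a series at a monomial
  \<open>x\<^sub>0\<^bsup>b0\<^esup> x\<^sub>1\<^bsup>b1\<^esup> \<cdots>\<close> with positive exponents by the average of the coefficients over all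
  rearrangements of the exponents. It fixes every symmetric function. It sends \<open>Q\<^sub>S\<close> to
  \<open>\<Xi>\<^sub>\<lambda>\<close> where \<open>\<lambda>\<close> is the type of \<open>S\<close>. Applied to \<open>g = \<Sum> b\<^sub>S Q\<^sub>S\<close> it gives
  \<open>g = \<Sum> b\<^sub>S \<Xi>\<^bsub>type S\<^esub>\<close>, and since the \<open>\<Xi>\<^sub>\<lambda>\<close> are linearly independent, comparing this with
  \<open>g = \<Sum> a\<^sub>\<lambda> \<Xi>\<^sub>\<lambda>\<close> yields the claim.

  The average of \<open>Q\<^sub>S\<close> is computed as follows. For the composition \<open>\<beta>\<close> of \<open>d\<close> formed by the exponents, the
  coefficient of \<open>Q\<^sub>S\<close> is the number of sets \<open>T\<close> with \<open>S \<subseteq> T \<subseteq> {1..<d}\<close> whose composition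
  is \<open>\<beta>\<close> (\<open>fundamental_qsym_word\<close>). Summing over all rearrangements of \<open>\<beta>\<close> counts the \<open>T\<close> whose pieces
  have the lengths in \<open>\<beta>\<close> in any order. On the other side, \<open>D\<^sub>\<lambda>\<close> is isomorphic to the path on \<open>1, \<dots>, d\<close>
  cut after the elements of \<open>S\<close> (\<open>linear_layout\<close>), so its edge subsets also correspond to the sets
  \<open>T\<close> between \<open>S\<close> and \<open>{1..<d}\<close>, and the components are the pieces of \<open>T\<close> (\<open>Xi_tilde_set_type\<close>). The weights
  agree because \<open>\<ell>! / (r\<^sub>1! r\<^sub>2! \<cdots>)\<close> is the number of rearrangements (\<open>Xi_tilde_word\<close>).

  Independence is triangularity with respect to the number of parts: removing edges from
  \<open>D\<^sub>\<lambda>\<close> creates more components (\<open>Xi_tilde_word_length\<close>, \<open>Xi_tilde_independent\<close>).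
\<close>

section \<open>Paths broken into pieces\<close>

definition steps :: "'a list \<Rightarrow> ('a \<times> 'a) set" where
  "steps xs = set (zip xs (tl xs))"

lemma steps_Cons_Cons: "steps (x # y # xs) = insert (x, y) (steps (y # xs))"
  by (simp add: steps_def)

lemma steps_trivial [simp]: "steps [] = {}" "steps [x] = {}"
  by (simp_all add: steps_def)

lemma steps_map: "steps (map f xs) = map_prod f f ` steps xs"
  by (simp add: steps_def map_tl [symmetric] zip_map_map map_prod_def)

lemma steps_upt: "steps [m..<n] = (\<lambda>j. (j, Suc j)) ` {m..<n - 1}"
proof (induction "n - m" arbitrary: m)
  case (Suc k)
  show ?case
  proof (cases "Suc m < n")
    case True
    then have "steps [m..<n] = insert (m, Suc m) (steps [Suc m..<n])"
      by (simp add: upt_conv_Cons steps_Cons_Cons)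
    also have "steps [Suc m..<n] = (\<lambda>j. (j, Suc j)) ` {Suc m..<n - 1}"
      using Suc by simp
    also have "insert (m, Suc m) \<dots> = (\<lambda>j. (j, Suc j)) ` insert m {Suc m..<n - 1}"
      by simp
    also have "insert m {Suc m..<n - 1} = {m..<n - 1}"
      using True by auto
    finally show ?thesis .
  next
    case False
    with Suc(2) have "n = Suc m" by simp
    then show ?thesis by simp
  qed
qed simp

lemma steps_subset: "(x, y) \<in> steps xs \<Longrightarrow> x \<in> set xs \<and> y \<in> set xs"
  unfolding steps_def by (metis in_set_zipE list.set_sel(2) tl_Nil)

lemma break_after_eq_Nil [simp]: "break_after S xs = [] \<longleftrightarrow> xs = []"
  by (induction S xs rule: break_after.induct) auto

lemma concat_break_after [simp]: "concat (break_after S xs) = xs"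
proof (induction S xs rule: break_after.induct)
  case (3 S x y xs)
  then show ?case
    by (cases "break_after S (y # xs)") (auto split: if_splits)
qed auto

lemma Nil_notin_break_after: "[] \<notin> set (break_after S xs)"
proof (induction S xs rule: break_after.induct)
  case (3 S x y xs)
  then show ?case
    by (cases "break_after S (y # xs)") (auto split: if_splits)
qed auto

lemma break_after_map:
  "inj_on f (S \<union> set xs) \<Longrightarrow> break_after (f ` S) (map f xs) = map (map f) (break_after S xs)"
proof (induction S xs rule: break_after.induct)
  case (3 S x y xs)
  have "inj_on f (S \<union> set (y # xs))"
    by (rule inj_on_subset [OF "3.prems"]) auto
  moreover have "f x \<in> f ` S \<longleftrightarrow> x \<in> S"
    by (rule inj_on_image_mem_iff [OF "3.prems"]) auto
  ultimately show ?case
    using "3.IH" by (cases "break_after S (y # xs)") (auto split: if_splits)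
qed auto

text \<open>
  Breaking a path after the elements of \<open>S\<close> deletes exactly the edges that leave an element of \<open>S\<close>.
  This is the dictionary between edge subsets of a path and sets of break points.
\<close>

lemma steps_break_after:
  "(\<Union>p\<in>set (break_after S xs). steps p) = {(x, y) \<in> steps xs. x \<notin> S}"
proof (induction S xs rule: break_after.induct)
  case (3 S x y xs)
  obtain p ps where ps: "break_after S (y # xs) = p # ps"
    by (metis break_after_eq_Nil list.distinct(1) list.exhaust)
  obtain p' where p: "p = y # p'"
    using concat_break_after [of S "y # xs"] Nil_notin_break_after [of S "y # xs"] ps
    by (cases p) auto
  have IH: "(\<Union>p\<in>set (break_after S (y # xs)). steps p) = {(u, v) \<in> steps (y # xs). u \<notin> S}"
    using "3.IH" by (cases "x \<in> S") auto
  show ?case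
    using IH unfolding ps p by (auto simp: steps_Cons_Cons ps p)
qed auto

text \<open>
  The last entry is left out of the count because breaking after it changes nothing.
\<close>

lemma length_break_after:
  assumes "distinct xs" "xs \<noteq> []"
  shows "length (break_after S xs) = Suc (card (S \<inter> set (butlast xs)))"
  using assms
proof (induction S xs rule: break_after.induct)
  case (3 S x y xs)
  have "x \<notin> set (butlast (y # xs))"
    using "3.prems"(1) by (auto dest: in_set_butlastD)
  then show ?case
    using 3 by (auto simp: Int_insert_right)
qed auto

lemma break_after_append:
  assumes "xs \<noteq> []" "S \<inter> set (butlast xs) = {}" "ys \<noteq> [] \<Longrightarrow> last xs \<in> S"
  shows "break_after S (xs @ ys) = xs # break_after S ys"
  using assms
proof (induction xs)
  case (Cons x xs)
  show ?case
  proof (cases xs)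
    case Nil
    then show ?thesis using Cons.prems by (cases ys) auto
  next
    case (Cons y zs)
    then show ?thesis using Cons.prems Cons.IH by (auto split: if_splits)
  qed
qed simp

lemma break_after_cong:
  assumes "\<And>x. x \<in> set (butlast xs) \<Longrightarrow> x \<in> S \<longleftrightarrow> x \<in> S'"
  shows "break_after S xs = break_after S' xs"
  using assms by (induction S xs rule: break_after.induct) auto

section \<open>Components of a union of paths\<close>

text \<open>
  A partition of the vertices is the one into weakly connected components as soon as no edge
  crosses between blocks and each block is connected.
\<close>

lemma components_eqI:
  assumes cover: "\<Union>P = V"
    and disj: "\<And>A B. A \<in> P \<Longrightarrow> B \<in> P \<Longrightarrow> A \<inter> B \<noteq> {} \<Longrightarrow> A = B"
    and nonempty: "{} \<notin> P"
    and inside: "\<And>x y. (x, y) \<in> F \<Longrightarrow> \<exists>A\<in>P. x \<in> A \<and> y \<in> A"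
    and conn: "\<And>A x y. A \<in> P \<Longrightarrow> x \<in> A \<Longrightarrow> y \<in> A \<Longrightarrow> (x, y) \<in> (F \<union> F\<inverse>)\<^sup>*"
  shows "components V F = P"
proof -
  let ?R = "(F \<union> F\<inverse>)\<^sup>* \<inter> V \<times> V"
  have stay: "y \<in> A" if "(x, y) \<in> (F \<union> F\<inverse>)\<^sup>*" "x \<in> A" "A \<in> P" for x y A
    using that
  proof (induction rule: rtrancl_induct)
    case (step y z)
    then obtain B where "B \<in> P" "y \<in> B" "z \<in> B" using inside by auto
    then show ?case using disj [of A B] step by auto
  qed
  have cls: "?R `` {x} = A" if "A \<in> P" "x \<in> A" for x A
    using stay that conn cover by blast
  show ?thesis
  proof (intro subset_antisym subsetI)
    fix A assume "A \<in> components V F"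
    then obtain x where "x \<in> V" "A = ?R `` {x}" unfolding components_def by (rule quotientE)
    then show "A \<in> P" using cls cover by blast
  next
    fix A assume "A \<in> P"
    moreover from this obtain x where "x \<in> A" using nonempty by fastforce
    ultimately show "A \<in> components V F"
      using cls [of A x] cover unfolding components_def by (auto intro: quotientI)
  qed
qed

lemma steps_connected:
  assumes "x \<in> set p" "y \<in> set p"
  shows "(x, y) \<in> (steps p \<union> (steps p)\<inverse>)\<^sup>*"
proof -
  have hd: "(hd p, z) \<in> (steps p)\<^sup>*" if "z \<in> set p" for z
    using that
  proof (induction p rule: induct_list012)
    case (3 u v p)
    show ?case
    proof (cases "z = u")
      case False
      then have "(v, z) \<in> (steps (v # p))\<^sup>*" using 3 by auto
      then have "(v, z) \<in> (steps (u # v # p))\<^sup>*"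
        by (rule rtrancl_mono [THEN subsetD, rotated]) (auto simp: steps_Cons_Cons)
      then show ?thesis
        by (auto simp: steps_Cons_Cons intro: converse_rtrancl_into_rtrancl)
    qed simp
  qed auto
  let ?R = "steps p \<union> (steps p)\<inverse>"
  have "(hd p, x) \<in> ?R\<^sup>*" "(hd p, y) \<in> ?R\<^sup>*"
    using hd assms by (meson Un_upper1 rtrancl_mono subsetD)+
  moreover have "sym (?R\<^sup>*)" by (simp add: sym_rtrancl sym_Un_converse)
  ultimately show ?thesis by (meson rtrancl_trans symD)
qed

lemma components_steps:
  assumes "distinct (concat ps)" "[] \<notin> set ps"
  shows "components (set (concat ps)) (\<Union>p\<in>set ps. steps p) = set ` set ps"
proof (rule components_eqI)
  fix A B assume "A \<in> set ` set ps" "B \<in> set ` set ps" "A \<inter> B \<noteq> {}"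
  then show "A = B" using assms(1) by (auto simp: distinct_concat_iff)
next
  fix x y assume "(x, y) \<in> (\<Union>p\<in>set ps. steps p)"
  then show "\<exists>A\<in>set ` set ps. x \<in> A \<and> y \<in> A" using steps_subset by fastforce
next
  fix A x y assume "A \<in> set ` set ps" "x \<in> A" "y \<in> A"
  then obtain p where p: "p \<in> set ps" "x \<in> set p" "y \<in> set p" by auto
  have "(steps p \<union> (steps p)\<inverse>)\<^sup>* \<subseteq>
      ((\<Union>p\<in>set ps. steps p) \<union> (\<Union>p\<in>set ps. steps p)\<inverse>)\<^sup>*"
    using p(1) by (intro rtrancl_mono) auto
  then show "(x, y) \<in> ((\<Union>p\<in>set ps. steps p) \<union> (\<Union>p\<in>set ps. steps p)\<inverse>)\<^sup>*"
    using steps_connected [OF p(2,3)] by blast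
qed (use assms(2) in auto)

text \<open>
  Passing from the list of paths to the set of their vertex sets loses no multiplicities, since
  disjoint nonempty paths have distinct vertex sets.
\<close>

lemma sizes_of_pieces:
  assumes "distinct (concat ps)" "[] \<notin> set ps"
  shows "image_mset card (mset_set (set ` set ps)) = mset (map length ps)"
proof -
  have "removeAll [] ps = ps" using assms(2) by simp
  then have d: "distinct ps" using assms(1) unfolding distinct_concat_iff by metis
  have "inj_on set (set ps)"
  proof (rule inj_onI)
    fix p q assume pq: "p \<in> set ps" "q \<in> set ps" "set p = set q"
    have "p \<noteq> []" using assms(2) pq(1) by blast
    then have "set p \<inter> set q \<noteq> {}" unfolding pq(3) [symmetric] by simp
    moreover have "\<forall>ys zs. ys \<in> set ps \<and> zs \<in> set ps \<and> ys \<noteq> zs \<longrightarrow> set ys \<inter> set zs = {}"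
      using assms(1) unfolding distinct_concat_iff by (elim conjE)
    ultimately show "p = q" using pq(1,2) by blast
  qed
  then have "mset_set (set ` set ps) = image_mset set (mset ps)"
    using d by (simp add: image_mset_mset_set [symmetric] mset_set_set)
  then have "image_mset card (mset_set (set ` set ps)) = image_mset (\<lambda>p. card (set p)) (mset ps)"
    by (simp add: multiset.map_comp comp_def)
  also have "\<dots> = image_mset length (mset ps)"
    using assms by (intro image_mset_cong distinct_card) (simp add: distinct_concat_iff)
  finally show ?thesis by simp
qed

section \<open>Compositions and the path digraph of a type\<close>

lemma mset_partition_of_mset [simp]: "mset (partition_of_mset A) = A"
  by (simp add: partition_of_mset_def)

lemma length_partition_of_mset [simp]: "length (partition_of_mset A) = size A"
  by (metis mset_partition_of_mset size_mset)

lemma sum_list_partition_of_mset [simp]: "sum_list (partition_of_mset A) = sum_mset A"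
  by (metis mset_partition_of_mset sum_mset_sum_list)

text \<open>
  \<^const>\<open>set_type\<close> forgets the order of the pieces. Remembering it gives the usual correspondence
  between subsets of \<open>{1..<d}\<close> and compositions of \<open>d\<close>.
\<close>

definition composition :: "nat \<Rightarrow> nat set \<Rightarrow> nat list" where
  "composition d S = map length (break_after S [1..<Suc d])"

lemma set_type_composition: "set_type d S = partition_of_mset (mset (composition d S))"
  by (simp add: set_type_def composition_def)

lemma sum_composition [simp]: "sum_list (composition d S) = d"
  unfolding composition_def
  by (metis concat_break_after length_concat length_upt diff_Suc_1)

lemma composition_pos: "k \<in> set (composition d S) \<Longrightarrow> 0 < k"
  using Nil_notin_break_after [of S "[1..<Suc d]"] by (fastforce simp: composition_def simp del: upt_Suc)

lemma sum_set_type [simp]: "sum_list (set_type d S) = d"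
  by (simp add: set_type_composition sum_mset_sum_list)

lemma integer_partition_set_type: "integer_partition (set_type d S)"
  using composition_pos[of _ d S]
  by (auto simp: integer_partition_def set_type_composition partition_of_mset_def sorted_wrt_rev)

lemma block_sizes_steps:
  assumes "distinct (concat ps)" "[] \<notin> set ps"
  shows "block_sizes (components (set (concat ps)) (\<Union>p\<in>set ps. steps p)) =
      partition_of_mset (mset (map length ps))"
    and "card (components (set (concat ps)) (\<Union>p\<in>set ps. steps p)) = length ps"
proof -
  note c = components_steps [OF assms] and s = sizes_of_pieces [OF assms]
  show "block_sizes (components (set (concat ps)) (\<Union>p\<in>set ps. steps p)) =
      partition_of_mset (mset (map length ps))"
    unfolding block_sizes_def c s ..
  show "card (components (set (concat ps)) (\<Union>p\<in>set ps. steps p)) = length ps"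
    unfolding c using arg_cong [OF s, of size] by simp
qed

lemma card_path_verts: "card (path_verts l) = sum_list l"
proof -
  have "path_verts l = Sigma {..<length l} (\<lambda>i. {..<l ! i})"
    by (auto simp: path_verts_def)
  then show ?thesis by (simp add: sum_list_sum_nth atLeast0LessThan)
qed

lemma steps_break_after_upt:
  "(\<Union>p\<in>set (break_after S [1..<Suc d]). steps p) = (\<lambda>j. (j, Suc j)) ` ({1..<d} - S)"
  unfolding steps_break_after by (auto simp: steps_upt simp del: upt_Suc)

text \<open>
  The digraph \<open>D\<^sub>\<lambda>\<close> with \<open>\<lambda>\<close> the type of \<open>S\<close> is a copy of the path \<open>1 \<rightarrow> 2 \<rightarrow> \<cdots> \<rightarrow> d\<close> with the edges
  leaving \<open>S\<close> removed: both are disjoint unions of paths with the same multiset of lengths. The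
  proof lists the paths of \<open>D\<^sub>\<lambda>\<close> in the order in which their lengths occur among the pieces of
  \<open>1, \<dots>, d\<close> and reads off the vertices.
\<close>

lemma linear_layout:
  obtains f where "inj_on f {1..<Suc d}" "f ` {1..<Suc d} = path_verts (set_type d S)"
    "path_edges (set_type d S) = (\<lambda>j. (f j, f (Suc j))) ` ({1..<d} - S)"
proof -
  define l where "l = set_type d S"
  define qs where "qs = break_after S [1..<Suc d]"
  have "mset (map length qs) = mset l"
    by (simp add: l_def qs_def set_type_def)
  then obtain \<sigma> where \<sigma>: "\<sigma> permutes {..<length l}" "permute_list \<sigma> l = map length qs"
    by (rule mset_eq_permutation)
  \<comment> \<open>the paths of \<open>D\<^sub>\<lambda>\<close>, reordered so that their lengths match those of the pieces\<close>
  define ps where "ps = map (\<lambda>i. map (Pair (\<sigma> i)) [0..<l ! \<sigma> i]) [0..<length l]"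
  have len: "map length ps = map length qs"
    unfolding \<sigma>(2) [symmetric] by (simp add: ps_def permute_list_def)
  have range: "\<sigma> ` {..<length l} = {..<length l}"
    using \<sigma>(1) by (rule permutes_image)
  have verts: "set (concat ps) = path_verts l"
  proof -
    have "set (concat ps) = (\<Union>i\<in>\<sigma> ` {..<length l}. Pair i ` {..<l ! i})"
      by (auto simp: ps_def)
    then show ?thesis unfolding range by (auto simp: path_verts_def)
  qed
  have edges: "(\<Union>p\<in>set ps. steps p) = path_edges l"
  proof -
    have "(\<Union>p\<in>set ps. steps p) = (\<Union>i\<in>\<sigma> ` {..<length l}. steps (map (Pair i) [0..<l ! i]))"
      by (auto simp: ps_def)
    then show ?thesis
      unfolding range by (force simp: path_edges_def steps_map steps_upt)
  qed
  have d: "length (concat ps) = d"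
    unfolding length_concat len
    using sum_composition [of d S] by (simp add: qs_def composition_def)
  \<comment> \<open>a listing of \<open>d\<close> vertices that reaches all \<open>d\<close> of them repeats none\<close>
  have dist: "distinct (concat ps)"
    using card_path_verts [of l] d unfolding verts [symmetric]
    by (intro card_distinct) (simp add: l_def)
  \<comment> \<open>labels start at 1, list positions at 0\<close>
  define f where "f j = concat ps ! (j - 1)" for j
  have f: "map f [1..<Suc d] = concat ps"
    using d by (intro nth_equalityI) (auto simp: f_def simp del: upt_Suc)
  have inj: "inj_on f {1..<Suc d}"
    using dist unfolding f [symmetric] by (simp add: distinct_map del: upt_Suc)
  have pieces: "map (map f) qs = ps"
  proof (rule concat_injective)
    show "concat (map (map f) qs) = concat ps"
      using f by (simp add: qs_def map_concat [symmetric] del: upt_Suc)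
    show "length (map (map f) qs) = length ps"
      using len by (metis length_map)
    show "\<forall>(x, y)\<in>set (zip (map (map f) qs) ps). length x = length y"
      using len by (auto simp: set_zip list_eq_iff_nth_eq)
  qed
  have "(\<Union>p\<in>set ps. steps p) = map_prod f f ` (\<Union>q\<in>set qs. steps q)"
    unfolding pieces [symmetric] by (simp add: steps_map image_UN)
  also have "\<dots> = map_prod f f ` (\<lambda>j. (j, Suc j)) ` ({1..<d} - S)"
    unfolding qs_def steps_break_after_upt ..
  finally have "path_edges l = (\<lambda>j. (f j, f (Suc j))) ` ({1..<d} - S)"
    unfolding edges image_image by simp
  moreover have "f ` {1..<Suc d} = path_verts l"
    using arg_cong [OF f, of set] verts by (simp del: upt_Suc)
  ultimately show ?thesis using that inj unfolding l_def by blast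
qed

lemma components_layout:
  fixes T :: "nat set"
  assumes f: "inj_on f {1..<Suc d}"
  defines "C \<equiv> components (f ` {1..<Suc d}) ((\<lambda>j. (f j, f (Suc j))) ` ({1..<d} - T))"
  shows "block_sizes C = set_type d T" "card C = length (set_type d T)"
proof -
  define qs where "qs = break_after T [1..<Suc d]"
  define ps where "ps = map (map f) qs"
  have c: "concat ps = map f [1..<Suc d]"
    by (simp add: ps_def qs_def map_concat [symmetric] del: upt_Suc)
  have "(\<Union>p\<in>set ps. steps p) = map_prod f f ` (\<Union>q\<in>set qs. steps q)"
    by (auto simp: ps_def steps_map)
  also have "\<dots> = (\<lambda>j. (f j, f (Suc j))) ` ({1..<d} - T)"
    unfolding qs_def steps_break_after_upt by (simp add: image_image)
  finally have C: "C = components (set (concat ps)) (\<Union>p\<in>set ps. steps p)"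
    unfolding C_def c by (simp del: upt_Suc)
  have dist: "distinct (concat ps)" unfolding c using f by (simp add: distinct_map del: upt_Suc)
  have Nil: "[] \<notin> set ps"
    using Nil_notin_break_after [of T "[1..<Suc d]"] by (auto simp: ps_def qs_def simp del: upt_Suc)
  have lengths: "map length ps = composition d T"
    by (simp add: ps_def qs_def composition_def comp_def)
  show "block_sizes C = set_type d T"
    unfolding C block_sizes_steps(1) [OF dist Nil] lengths set_type_composition ..
  have "length ps = length (set_type d T)"
    using arg_cong [OF lengths, of length] by (simp add: set_type_composition)
  then show "card C = length (set_type d T)"
    unfolding C block_sizes_steps(2) [OF dist Nil] .
qed

text \<open>
  In the linear copy of \<open>D\<^sub>\<lambda>\<close>, choosing a subset of the edges means enlarging \<open>S\<close> to the set \<open>T\<close> of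
  all break points, and the spanning subgraph then consists of the pieces cut out by \<open>T\<close>. So
  the sum over edge subsets becomes a sum over the sets between \<open>S\<close> and \<open>{1..<d}\<close>.
\<close>

lemma Xi_tilde_set_type:
  assumes "S \<subseteq> {1..<d}"
  shows "Xi_tilde (set_type d S) M =
    (\<Sum>T | S \<subseteq> T \<and> T \<subseteq> {1..<d}. aug_monomial_sym (set_type d T) M / fact (length (set_type d T)))"
proof -
  obtain f where f: "inj_on f {1..<Suc d}" "f ` {1..<Suc d} = path_verts (set_type d S)"
    "path_edges (set_type d S) = (\<lambda>j. (f j, f (Suc j))) ` ({1..<d} - S)"
    using linear_layout .
  let ?h = "\<lambda>j. (f j, f (Suc j))"
  have h: "inj_on ?h {1..<d}"
  proof (rule inj_onI)
    fix i j assume "i \<in> {1..<d}" "j \<in> {1..<d}" "?h i = ?h j"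
    then show "i = j" using inj_onD [OF f(1), of i j] by simp
  qed
  have "bij_betw (\<lambda>T. {1..<d} - T) {T. S \<subseteq> T \<and> T \<subseteq> {1..<d}} (Pow ({1..<d} - S))"
    using assms by (intro bij_betwI [where g = "\<lambda>U. {1..<d} - U"]) auto
  moreover have "bij_betw (image ?h) (Pow ({1..<d} - S)) (Pow (path_edges (set_type d S)))"
    unfolding f(3)
    by (intro bij_betw_Pow inj_on_imp_bij_betw inj_on_subset [OF h]) auto
  ultimately have bij: "bij_betw (\<lambda>T. ?h ` ({1..<d} - T)) {T. S \<subseteq> T \<and> T \<subseteq> {1..<d}}
      (Pow (path_edges (set_type d S)))"
    by (rule bij_betw_trans [unfolded comp_def])
  show ?thesis
    unfolding Xi_tilde_def sum.reindex_bij_betw [OF bij, symmetric] f(2) [symmetric]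
  proof (rule sum.cong)
    fix T
    from components_layout [OF f(1)]
    show "aug_monomial_sym (block_sizes (components (f ` {1..<Suc d}) (?h ` ({1..<d} - T)))) M /
        fact (card (components (f ` {1..<Suc d}) (?h ` ({1..<d} - T)))) =
        aug_monomial_sym (set_type d T) M / fact (length (set_type d T))"
      by (simp only:)
  qed simp
qed

section \<open>Subsets and compositions\<close>

text \<open>
  This is the triangularity behind linear independence: properly enlarging the set of break
  points strictly increases the number of pieces.
\<close>

lemma set_type_refines:
  assumes "S \<subseteq> T" "T \<subseteq> {1..<d}"
  shows "length (set_type d S) \<le> length (set_type d T)"
    and "length (set_type d T) = length (set_type d S) \<Longrightarrow> T = S"
proof -
  have len: "length (set_type d U) = (if d = 0 then 0 else Suc (card U))" if "U \<subseteq> {1..<d}" for U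
  proof -
    have "U \<inter> {1..<d} = U" using that by auto
    then show ?thesis
      using length_break_after [of "[1..<Suc d]" U]
      by (auto simp: set_type_composition composition_def)
  qed
  have fin: "finite T" using assms(2) finite_subset by blast
  have S: "S \<subseteq> {1..<d}" using assms by blast
  show "length (set_type d S) \<le> length (set_type d T)"
    using card_mono [OF fin assms(1)] by (simp add: len [OF S] len [OF assms(2)])
  show "T = S" if "length (set_type d T) = length (set_type d S)"
    using that assms card_subset_eq [OF fin assms(1)] by (auto simp: len [OF S] len [OF assms(2)] split: if_splits)
qed

text \<open>
  The lengths of the pieces and their concatenation determine the pieces, hence the edges that
  survive, hence the break points.
\<close>

lemma composition_inject:
  assumes "S \<subseteq> {1..<d}" "T \<subseteq> {1..<d}" "composition d S = composition d T"
  shows "S = T"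
proof -
  have "break_after S [1..<Suc d] = break_after T [1..<Suc d]"
  proof (rule concat_injective)
    show "length (break_after S [1..<Suc d]) = length (break_after T [1..<Suc d])"
      using assms(3) unfolding composition_def by (metis length_map)
    show "\<forall>(x, y)\<in>set (zip (break_after S [1..<Suc d]) (break_after T [1..<Suc d])).
        length x = length y"
      using assms(3) by (auto simp: composition_def set_zip list_eq_iff_nth_eq simp del: upt_Suc)
  qed simp
  then have "(\<lambda>j. (j, Suc j)) ` ({1..<d} - S) = (\<lambda>j. (j, Suc j)) ` ({1..<d} - T)"
    by (metis steps_break_after_upt)
  then have "{1..<d} - S = {1..<d} - T" by (simp add: inj_image_eq_iff inj_def)
  with assms show ?thesis by blast
qed

section \<open>Monomials with given exponents\<close>

text \<open>
  The weakly increasing index sequence in which the \<open>i\<close>-th value from \<open>k\<close> on is repeated as often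
  as the \<open>i\<close>-th entry of the list says. For \<open>k = 0\<close> its multiset is the monomial
  \<open>x\<^sub>0\<^bsup>b0\<^esup> x\<^sub>1\<^bsup>b1\<^esup> \<cdots>\<close>. The start value \<open>k\<close> is there for induction.
\<close>

fun word :: "nat \<Rightarrow> nat list \<Rightarrow> nat list" where
  "word k [] = []"
| "word k (b # bs) = replicate b k @ word (Suc k) bs"

definition rises :: "nat list \<Rightarrow> nat set" where
  "rises w = {j. 0 < j \<and> j < length w \<and> w ! (j - 1) < w ! j}"

lemma length_word [simp]: "length (word k bs) = sum_list bs"
  by (induction bs arbitrary: k) auto

lemma word_ge: "x \<in> set (word k bs) \<Longrightarrow> k \<le> x"
  by (induction bs arbitrary: k) (fastforce dest: Suc_leD)+

lemma sorted_word: "sorted (word k bs)"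
  by (induction bs arbitrary: k) (auto simp: sorted_append dest: word_ge)

lemma count_word:
  "count (mset (word k bs)) i = (if k \<le> i \<and> i < k + length bs then bs ! (i - k) else 0)"
proof (induction bs arbitrary: k)
  case (Cons b bs)
  then show ?case
    by (auto simp: nth_Cons')
qed simp

lemma exponents_union:
  assumes "set_mset M \<inter> set_mset N = {}"
  shows "exponents (M + N) = exponents M + exponents N"
proof -
  have "exponents (M + N) = image_mset (count (M + N)) (mset_set (set_mset M)) +
      image_mset (count (M + N)) (mset_set (set_mset N))"
    using assms by (simp add: exponents_def mset_set_Union)
  also have "image_mset (count (M + N)) (mset_set (set_mset M)) = exponents M"
    unfolding exponents_def using assms by (intro image_mset_cong) (auto simp: not_in_iff)
  also have "image_mset (count (M + N)) (mset_set (set_mset N)) = exponents N"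
    unfolding exponents_def using assms by (intro image_mset_cong) (auto simp: not_in_iff)
  finally show ?thesis .
qed

lemma exponents_word:
  "0 \<notin> set bs \<Longrightarrow> exponents (mset (word k bs)) = mset bs"
proof (induction bs arbitrary: k)
  case (Cons b bs)
  have "exponents (mset (replicate b k)) = {#b#}"
    using Cons.prems by (auto simp: exponents_def)
  moreover have "set (replicate b k) \<inter> set (word (Suc k) bs) = {}"
    by (fastforce dest: word_ge)
  ultimately show ?case using Cons by (simp add: exponents_union)
qed (simp add: exponents_def)

lemma rises_append:
  assumes "0 < b" "\<And>x. x \<in> set w \<Longrightarrow> k < x"
  shows "rises (replicate b k @ w) = (if w = [] then {} else insert b ((+) b ` rises w))"
proof (intro set_eqI)
  fix j
  consider "j < b" | "j = b" | i where "j = b + i" "0 < i"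
    by (metis less_imp_add_positive linorder_neqE_nat)
  then show "j \<in> rises (replicate b k @ w) \<longleftrightarrow>
      j \<in> (if w = [] then {} else insert b ((+) b ` rises w))"
  proof cases
    case 1
    then show ?thesis by (auto simp: rises_def nth_append)
  next
    case 2
    then show ?thesis using assms by (auto simp: rises_def nth_append)
  next
    case 3
    then have "(b + i - 1 < b) = False" "b + i - 1 - b = i - 1" by auto
    with 3 show ?thesis by (auto simp: rises_def nth_append)
  qed
qed

lemma upt_add_split: "[1..<Suc (b + n)] = [1..<Suc b] @ map ((+) b) [1..<Suc n]"
  by (rule nth_equalityI) (auto simp: nth_append simp del: upt_Suc)

text \<open>
  The rises of the word are the places where one block of equal values meets the next, so
  cutting there recovers the block lengths. With \<open>composition_inject\<close> this shows that the
  rises are the only set with the given composition.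
\<close>

lemma composition_rises:
  "0 \<notin> set bs \<Longrightarrow> composition (sum_list bs) (rises (word k bs)) = bs"
proof (induction bs arbitrary: k)
  case (Cons b bs)
  define n where "n = sum_list bs"
  define R where "R = rises (word k (b # bs))"
  define R' where "R' = rises (word (Suc k) bs)"
  have b: "0 < b" and pos: "0 \<notin> set bs" using Cons.prems by auto
  have nil: "word (Suc k) bs = [] \<longleftrightarrow> n = 0"
    unfolding n_def by (metis length_word length_0_conv)
  have "\<And>x. x \<in> set (word (Suc k) bs) \<Longrightarrow> k < x"
    by (drule word_ge) simp
  then have R: "R = (if n = 0 then {} else insert b ((+) b ` R'))"
    using rises_append [OF b, of "word (Suc k) bs" k] unfolding nil by (simp add: R_def R'_def)
  have "break_after R ([1..<Suc b] @ map ((+) b) [1..<Suc n]) =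
      [1..<Suc b] # break_after R (map ((+) b) [1..<Suc n])"
  proof (rule break_after_append)
    show "R \<inter> set (butlast [1..<Suc b]) = {}" by (auto simp: R)
    show "last [1..<Suc b] \<in> R" if "map ((+) b) [1..<Suc n] \<noteq> []"
    proof -
      have "0 < n" using that by (cases n) simp_all
      then show ?thesis using b by (simp add: R)
    qed
  qed (use b in simp)
  also have "break_after R (map ((+) b) [1..<Suc n]) =
      break_after ((+) b ` R') (map ((+) b) [1..<Suc n])"
  proof (rule break_after_cong)
    fix x assume "x \<in> set (butlast (map ((+) b) [1..<Suc n]))"
    moreover have "butlast [1..<Suc n] = [1..<n]" by (cases n) simp_all
    ultimately have "x \<in> set (map ((+) b) [1..<n])" by (simp only: map_butlast [symmetric])
    then have "0 < n" "b < x" by auto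
    then show "x \<in> R \<longleftrightarrow> x \<in> (+) b ` R'" by (simp add: R)
  qed
  also have "\<dots> = map (map ((+) b)) (break_after R' [1..<Suc n])"
    by (intro break_after_map) simp
  finally have "composition (b + n) R = b # composition n R'"
    unfolding composition_def upt_add_split by (simp add: comp_def del: upt_Suc)
  also have "composition n R' = bs"
    unfolding n_def R'_def using pos by (rule Cons.IH)
  finally show ?case by (simp add: R_def n_def)
qed (simp add: composition_def)

lemma rises_subset: "rises w \<subseteq> {1..<length w}"
  by (auto simp: rises_def)

text \<open>
  The expansion of \<open>Q\<^sub>S\<close> into monomial quasi-symmetric functions, read off at one monomial: the sum
  runs over the sets \<open>T \<supseteq> S\<close>, and each contributes to the single composition that belongs to it.
  Both sides are 0 or 1.
\<close>

lemma fundamental_qsym_word: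
  assumes "0 \<notin> set bs" "S \<subseteq> {1..<d}"
  shows "fundamental_qsym d S (mset (word 0 bs)) =
    of_nat (card {T. S \<subseteq> T \<and> T \<subseteq> {1..<d} \<and> composition d T = bs})"
proof (cases "sum_list bs = d")
  case True
  define w where "w = word 0 bs"
  have len: "length w = d" using True by (simp add: w_def)
  have sorted: "sorted w" unfolding w_def by (rule sorted_word)
  have uniq: "is = w" if "sorted is" "mset is = mset w" for "is"
    using that sorted by (metis properties_for_sort sorted_sort_id)
  have "length is = d \<and> sorted is \<and> (\<forall>j\<in>S. is ! (j - 1) < is ! j) \<and> mset is = mset w \<longleftrightarrow>
      is = w \<and> (\<forall>j\<in>S. w ! (j - 1) < w ! j)" for "is"
    using uniq [of "is"] len sorted by blast
  then have "{is. length is = d \<and> sorted is \<and> (\<forall>j\<in>S. is ! (j - 1) < is ! j) \<and> mset is = mset w} =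
      (if \<forall>j\<in>S. w ! (j - 1) < w ! j then {w} else {})"
    by (simp only:) simp
  moreover have "(\<forall>j\<in>S. w ! (j - 1) < w ! j) \<longleftrightarrow> S \<subseteq> rises w"
  proof -
    have "0 < j \<and> j < length w" if "j \<in> S" for j
      using that assms(2) len by fastforce
    then show ?thesis unfolding rises_def by blast
  qed
  moreover have "{T. S \<subseteq> T \<and> T \<subseteq> {1..<d} \<and> composition d T = bs} =
      (if S \<subseteq> rises w then {rises w} else {})"
  proof -
    have comp: "composition d (rises w) = bs"
      using composition_rises [OF assms(1), of 0] True by (simp add: w_def)
    have sub: "rises w \<subseteq> {1..<d}" using rises_subset [of w] len by simp
    have "S \<subseteq> T \<and> T \<subseteq> {1..<d} \<and> composition d T = bs \<longleftrightarrow> T = rises w \<and> S \<subseteq> rises w" for T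
      using composition_inject [OF _ sub] comp sub by metis
    then show ?thesis by simp
  qed
  ultimately show ?thesis
    unfolding fundamental_qsym_def w_def [symmetric] by (simp only:) simp
next
  case False
  then have "{is. length is = d \<and> sorted is \<and> (\<forall>j\<in>S. is ! (j - 1) < is ! j) \<and>
      mset is = mset (word 0 bs)} = {}"
    by (auto dest: mset_eq_length)
  moreover have "{T. S \<subseteq> T \<and> T \<subseteq> {1..<d} \<and> composition d T = bs} = {}"
    using False by auto
  ultimately show ?thesis unfolding fundamental_qsym_def by (simp only: card.empty)
qed

text \<open>
  A permutation of the parts of the exponent vector is induced by a permutation of the variables.
\<close>

lemma symmetric_function_word:
  assumes "symmetric_function g" "mset as = mset bs"
  shows "g (mset (word 0 as)) = g (mset (word 0 bs))"
proof -
  obtain p where p: "p permutes {..<length bs}" "permute_list p bs = as"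
    using mset_eq_permutation [OF assms(2)] .
  have len: "length as = length bs" using p by auto
  have bij: "bij p" using p(1) by (rule permutes_bij)
  have "image_mset p (mset (word 0 as)) = mset (word 0 bs)"
  proof (rule multiset_eqI)
    fix i
    obtain j where i: "i = p j" using bij by (metis bij_pointE)
    have "count (image_mset p A) (p j) = count A j" for A
      using bij_is_inj [OF bij] by (induction A) (simp_all add: inj_eq)
    then have "count (image_mset p (mset (word 0 as))) (p j) = count (mset (word 0 as)) j" .
    also have "\<dots> = count (mset (word 0 bs)) (p j)"
      using p permutes_in_image [OF p(1), of j]
      by (auto simp: count_word len permute_list_nth)
    finally show "count (image_mset p (mset (word 0 as))) i = count (mset (word 0 bs)) i"
      by (simp add: i)
  qed
  then show ?thesis using assms(1) bij unfolding symmetric_function_def by metis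
qed

section \<open>Averaging over rearrangements of the exponents\<close>

lemma aug_monomial_sym_word:
  assumes "0 \<notin> set bs"
  shows "aug_monomial_sym l (mset (word 0 bs)) =
    (if mset l = mset bs then (\<Prod>i\<in>set bs. fact (count (mset bs) i)) else 0)"
  using assms
proof (cases "mset l = mset bs")
  case True
  then have "set l = set bs" "\<And>i. count_list l i = count (mset bs) i"
    by (metis mset_eq_setD, metis count_mset)
  with True assms show ?thesis
    by (simp add: aug_monomial_sym_def monomial_sym_def exponents_word)
next
  case False
  with assms show ?thesis by (auto simp: aug_monomial_sym_def monomial_sym_def exponents_word)
qed

text \<open>
  The factor \<open>r\<^sub>1! r\<^sub>2! \<cdots> / \<ell>!\<close> in the definition of \<open>\<Xi>\<close> is one over the number of rearrangements of a
  composition with \<open>\<ell>\<close> parts of which \<open>r\<^sub>i\<close> equal \<open>i\<close>. After multiplication by that number only a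
  count of sets \<open>T\<close> is left.
\<close>

lemma Xi_tilde_word:
  assumes "0 \<notin> set bs" "S \<subseteq> {1..<d}"
  shows "of_nat (card (permutations_of_multiset (mset bs))) *
      Xi_tilde (set_type d S) (mset (word 0 bs)) =
    of_nat (card {T. S \<subseteq> T \<and> T \<subseteq> {1..<d} \<and> mset (composition d T) = mset bs})"
proof -
  let ?N = "of_nat (card (permutations_of_multiset (mset bs))) :: rat"
  let ?r = "(\<Prod>i\<in>set bs. fact (count (mset bs) i)) :: rat"
  let ?U = "{T. S \<subseteq> T \<and> T \<subseteq> {1..<d}}"
  have "?U \<subseteq> Pow {1..<d}" by auto
  then have fin: "finite ?U" by (rule finite_subset) simp
  have N: "?N * ?r = fact (length bs)"
    using arg_cong [OF card_permutations_of_multiset_aux [of "mset bs"], of "of_nat :: nat \<Rightarrow> rat"]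
    by simp
  have "Xi_tilde (set_type d S) (mset (word 0 bs)) =
      (\<Sum>T\<in>?U. if mset (composition d T) = mset bs then ?r / fact (length bs) else 0)"
    unfolding Xi_tilde_set_type [OF assms(2)] aug_monomial_sym_word [OF assms(1)]
    by (intro sum.cong) (auto simp: set_type_composition dest: mset_eq_length)
  also have "\<dots> = of_nat (card {T \<in> ?U. mset (composition d T) = mset bs}) *
      (?r / fact (length bs))"
    unfolding sum.inter_filter [OF fin, symmetric] sum_constant ..
  finally have "?N * Xi_tilde (set_type d S) (mset (word 0 bs)) =
      of_nat (card {T \<in> ?U. mset (composition d T) = mset bs}) * (?N * ?r / fact (length bs))"
    by simp
  then show ?thesis by (simp add: N conj_assoc)
qed

lemma card_permutations_of_multiset_nonzero: "card (permutations_of_multiset A) \<noteq> 0"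
  using card_permutations_of_multiset_aux [of A] by (metis fact_nonzero mult_zero_left)

text \<open>
  The key identity: averaging the coefficients of \<open>Q\<^sub>S\<close> over all rearrangements of the exponents
  gives the coefficient of \<open>\<Xi>\<close> for the type of \<open>S\<close>. The sum over rearrangements relaxes the condition
  that \<open>T\<close> has a prescribed composition to the condition that it has a prescribed multiset of
  piece lengths.
\<close>

lemma sum_fundamental_qsym:
  assumes "0 \<notin> set bs" "S \<subseteq> {1..<d}"
  shows "(\<Sum>cs\<in>permutations_of_multiset (mset bs). fundamental_qsym d S (mset (word 0 cs))) =
    of_nat (card (permutations_of_multiset (mset bs))) *
      Xi_tilde (set_type d S) (mset (word 0 bs))"
proof -
  let ?P = "permutations_of_multiset (mset bs)"
  let ?U = "\<lambda>cs. {T. S \<subseteq> T \<and> T \<subseteq> {1..<d} \<and> composition d T = cs}"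
  have fin: "finite (?U cs)" for cs
    by (rule finite_subset [of _ "Pow {1..<d}"]) auto
  have "(\<Sum>cs\<in>?P. fundamental_qsym d S (mset (word 0 cs))) = (\<Sum>cs\<in>?P. of_nat (card (?U cs)))"
  proof (rule sum.cong)
    fix cs assume "cs \<in> ?P"
    then have "0 \<notin> set cs" using assms(1) by (metis permutations_of_multisetD mset_eq_setD)
    then show "fundamental_qsym d S (mset (word 0 cs)) = of_nat (card (?U cs))"
      using assms(2) by (rule fundamental_qsym_word)
  qed simp
  also have "\<dots> = of_nat (card (\<Union>cs\<in>?P. ?U cs))"
    by (subst card_UN_disjoint) (use fin in auto)
  also have "(\<Union>cs\<in>?P. ?U cs) =
      {T. S \<subseteq> T \<and> T \<subseteq> {1..<d} \<and> mset (composition d T) = mset bs}"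
    by (auto simp: permutations_of_multiset_def)
  finally show ?thesis unfolding Xi_tilde_word [OF assms] .
qed

text \<open>
  Averaging over rearrangements does nothing to a symmetric function, so any expansion of it in
  the \<open>Q\<^sub>S\<close> remains true when each \<open>Q\<^sub>S\<close> is replaced by its average.
\<close>

lemma symmetric_function_eq_sum_Xi_tilde:
  assumes sym: "symmetric_function g"
    and g: "g = (\<lambda>M. \<Sum>(d, S)\<in>B. b d S * fundamental_qsym d S M)"
    and B: "\<And>d S. (d, S) \<in> B \<Longrightarrow> S \<subseteq> {1..<d}"
    and bs: "0 \<notin> set bs"
  shows "g (mset (word 0 bs)) = (\<Sum>(d, S)\<in>B. b d S * Xi_tilde (set_type d S) (mset (word 0 bs)))"
proof -
  let ?P = "permutations_of_multiset (mset bs)"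
  let ?N = "of_nat (card ?P) :: rat"
  have "?N * g (mset (word 0 bs)) = (\<Sum>cs\<in>?P. g (mset (word 0 bs)))"
    by simp
  also have "\<dots> = (\<Sum>cs\<in>?P. g (mset (word 0 cs)))"
    by (intro sum.cong refl symmetric_function_word [OF sym])
      (simp add: permutations_of_multiset_def)
  also have "\<dots> = (\<Sum>(d, S)\<in>B. b d S * (\<Sum>cs\<in>?P. fundamental_qsym d S (mset (word 0 cs))))"
    unfolding g by (subst sum.swap) (simp add: sum_distrib_left case_prod_unfold)
  also have "\<dots> = (\<Sum>(d, S)\<in>B. b d S * (?N * Xi_tilde (set_type d S) (mset (word 0 bs))))"
    by (intro sum.cong) (auto simp: sum_fundamental_qsym [OF bs B])
  also have "\<dots> = ?N * (\<Sum>(d, S)\<in>B. b d S * Xi_tilde (set_type d S) (mset (word 0 bs)))"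
    by (simp add: sum_distrib_left case_prod_unfold ac_simps)
  finally have "?N * g (mset (word 0 bs)) =
      ?N * (\<Sum>(d, S)\<in>B. b d S * Xi_tilde (set_type d S) (mset (word 0 bs)))" .
  then show ?thesis using card_permutations_of_multiset_nonzero [of "mset bs"] by simp
qed

section \<open>Linear independence\<close>

lemma integer_partition_pos: "integer_partition l \<Longrightarrow> 0 \<notin> set l"
  by (auto simp: integer_partition_def)

lemma integer_partition_unique:
  assumes "integer_partition l" "mset A = mset l"
  shows "partition_of_mset (mset A) = l"
proof -
  have "sorted (rev l)" using assms(1) by (simp add: integer_partition_def sorted_wrt_rev)
  then have "sort l = rev l" by (intro properties_for_sort) simp_all
  then show ?thesis using assms(2) by (simp add: partition_of_mset_def)
qed

text \<open>
  Every partition is a type, for instance of the rises of its own word. So the expansion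
  \<open>Xi_tilde_set_type\<close> applies to all \<open>\<Xi>\<^sub>\<lambda>\<close>.
\<close>

lemma integer_partition_eq_set_type:
  assumes "integer_partition l"
  obtains S where "S \<subseteq> {1..<sum_list l}" "set_type (sum_list l) S = l"
proof
  show "rises (word 0 l) \<subseteq> {1..<sum_list l}" using rises_subset [of "word 0 l"] by simp
  show "set_type (sum_list l) (rises (word 0 l)) = l"
    using composition_rises [OF integer_partition_pos] integer_partition_unique assms
    by (simp add: set_type_composition)
qed

text \<open>
  A spanning subgraph has at least as many components as \<open>D\<^sub>\<lambda>\<close> has paths, with equality only if no edge
  is removed. Hence \<open>\<Xi>\<^sub>\<lambda>\<close> is supported on \<open>\<lambda>\<close> itself and on partitions with more parts.
\<close>

lemma Xi_tilde_word_length: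
  assumes l: "integer_partition l" and m: "integer_partition m"
    and nz: "Xi_tilde l (mset (word 0 m)) \<noteq> 0" and le: "length m \<le> length l"
  shows "l = m"
proof -
  define d where "d = sum_list l"
  obtain S where S: "S \<subseteq> {1..<d}" "set_type d S = l"
    using integer_partition_eq_set_type [OF l] unfolding d_def .
  have "of_nat (card {T. S \<subseteq> T \<and> T \<subseteq> {1..<d} \<and> mset (composition d T) = mset m}) \<noteq> (0::rat)"
    unfolding Xi_tilde_word [OF integer_partition_pos [OF m] S(1), symmetric] S(2)
    using nz card_permutations_of_multiset_nonzero [of "mset m"] by simp
  then have "{T. S \<subseteq> T \<and> T \<subseteq> {1..<d} \<and> mset (composition d T) = mset m} \<noteq> {}"
    by (metis card.empty of_nat_0)
  then obtain T where T: "S \<subseteq> T" "T \<subseteq> {1..<d}" "mset (composition d T) = mset m" by blast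
  have "set_type d T = m"
    using integer_partition_unique [OF m T(3)] by (simp add: set_type_composition T(3))
  moreover from this have "T = S"
    using set_type_refines [OF T(1,2)] le S(2) by simp
  ultimately show ?thesis using S(2) by simp
qed

lemma Xi_tilde_word_self:
  assumes l: "integer_partition l"
  shows "Xi_tilde l (mset (word 0 l)) \<noteq> 0"
proof -
  define d where "d = sum_list l"
  obtain S where S: "S \<subseteq> {1..<d}" "set_type d S = l"
    using integer_partition_eq_set_type [OF l] unfolding d_def .
  let ?U = "{T. S \<subseteq> T \<and> T \<subseteq> {1..<d} \<and> mset (composition d T) = mset l}"
  have "mset (composition d S) = mset l"
    using S(2) by (metis mset_partition_of_mset set_type_composition)
  then have "S \<in> ?U" using S(1) by blast
  moreover have "finite ?U" by (rule finite_subset [of _ "Pow {1..<d}"]) auto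
  ultimately have "card ?U \<noteq> 0" by auto
  then show ?thesis
    using Xi_tilde_word [OF integer_partition_pos [OF l] S(1)] S(2) by auto
qed

text \<open>
  By the triangularity with respect to the number of parts: at the monomial of \<open>l\<close>, the partitions
  with fewer parts have coefficient 0 by induction, and among the remaining ones only
  \<open>\<Xi>\<^sub>l\<close> is nonzero there.
\<close>

lemma Xi_tilde_independent:
  fixes c :: "nat list \<Rightarrow> rat"
  assumes fin: "finite L" and L: "\<And>l. l \<in> L \<Longrightarrow> integer_partition l"
    and zero: "\<And>bs. 0 \<notin> set bs \<Longrightarrow> (\<Sum>l\<in>L. c l * Xi_tilde l (mset (word 0 bs))) = 0"
    and "l \<in> L"
  shows "c l = 0"
  using \<open>l \<in> L\<close>
proof (induction "length l" arbitrary: l rule: less_induct)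
  case less
  have "c l' * Xi_tilde l' (mset (word 0 l)) = 0" if l': "l' \<in> L - {l}" for l'
  proof (cases "length l' < length l")
    case True
    then have "c l' = 0" using l' by (intro less.hyps) simp_all
    then show ?thesis by simp
  next
    case False
    then have "Xi_tilde l' (mset (word 0 l)) = 0"
      using Xi_tilde_word_length [of l' l] L [of l'] L [of l] l' less.prems by fastforce
    then show ?thesis by simp
  qed
  then have "(\<Sum>l'\<in>L - {l}. c l' * Xi_tilde l' (mset (word 0 l))) = 0"
    by (intro sum.neutral ballI)
  then have "c l * Xi_tilde l (mset (word 0 l)) = 0"
    using zero [OF integer_partition_pos [OF L [OF less.prems]]]
    unfolding sum.remove [OF fin less.prems] by simp
  then show ?case using Xi_tilde_word_self [OF L [OF less.prems]] by simp
qed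

section \<open>Comparison of the two expansions\<close>

theorem theorem4:
  fixes g :: series
    and a :: "nat list \<Rightarrow> rat"
    and b :: "nat \<Rightarrow> nat set \<Rightarrow> rat"
  assumes "symmetric_function g"
    and "finite {l. integer_partition l \<and> a l \<noteq> 0}"
    and "g = (\<lambda>M. \<Sum>l | integer_partition l \<and> a l \<noteq> 0. a l * Xi_tilde l M)"
    and "finite {(d, S). S \<subseteq> {1..<d} \<and> b d S \<noteq> 0}"
    and "g = (\<lambda>M. \<Sum>(d, S)\<in>{(d, S). S \<subseteq> {1..<d} \<and> b d S \<noteq> 0}. b d S * fundamental_qsym d S M)"
  shows "\<forall>l. integer_partition l \<longrightarrow>
    a l = (\<Sum>S | S \<subseteq> {1..<sum_list l} \<and> set_type (sum_list l) S = l. b (sum_list l) S)"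
proof (intro allI impI)
  fix l assume l: "integer_partition l"
  define A where "A = {l. integer_partition l \<and> a l \<noteq> 0}"
  define B where "B = {(d, S). S \<subseteq> {1..<d} \<and> b d S \<noteq> 0}"
  define a' where
    "a' m = (\<Sum>S | S \<subseteq> {1..<sum_list m} \<and> set_type (sum_list m) S = m. b (sum_list m) S)" for m
  define shape where "shape x = set_type (fst x) (snd x)" for x
  have A: "finite A" and gA: "g = (\<lambda>M. \<Sum>l\<in>A. a l * Xi_tilde l M)"
    using assms(2,3) unfolding A_def by blast+
  have B: "finite B" and gB: "g = (\<lambda>M. \<Sum>(d, S)\<in>B. b d S * fundamental_qsym d S M)"
    using assms(4,5) unfolding B_def by blast+
  have in_B: "(d, S) \<in> B \<longleftrightarrow> S \<subseteq> {1..<d} \<and> b d S \<noteq> 0" for d S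
    by (simp add: B_def)
  \<comment> \<open>\<open>l\<close> is added because it may occur in neither expansion\<close>
  define L where "L = insert l (A \<union> shape ` B)"
  have fin: "finite L" using A B by (simp add: L_def)
  have part: "integer_partition m" if "m \<in> L" for m
    using that l integer_partition_set_type unfolding L_def A_def shape_def by blast
  have fiber: "(\<Sum>(d, S)\<in>{x \<in> B. shape x = m}. b d S) = a' m" for m
  proof -
    let ?n = "sum_list m"
    let ?F = "{S. S \<subseteq> {1..<?n} \<and> set_type ?n S = m}"
    have "{x \<in> B. shape x = m} = Pair ?n ` {S \<in> ?F. b ?n S \<noteq> 0}"
    proof (intro set_eqI)
      fix x :: "nat \<times> nat set"
      obtain d S where x: "x = (d, S)" by fastforce
      have "set_type d S = m \<longleftrightarrow> d = ?n \<and> set_type ?n S = m"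
        by (metis sum_set_type)
      then show "x \<in> {x \<in> B. shape x = m} \<longleftrightarrow> x \<in> Pair ?n ` {S \<in> ?F. b ?n S \<noteq> 0}"
        unfolding x by (auto simp: in_B shape_def)
    qed
    then have "(\<Sum>(d, S)\<in>{x \<in> B. shape x = m}. b d S) = (\<Sum>S\<in>{S \<in> ?F. b ?n S \<noteq> 0}. b ?n S)"
      by (simp add: sum.reindex inj_on_def)
    also have "\<dots> = (\<Sum>S\<in>?F. b ?n S)"
    proof (rule sum.mono_neutral_left)
      show "finite ?F" by (rule finite_subset [of _ "Pow {1..<?n}"]) auto
    qed auto
    finally show ?thesis unfolding a'_def .
  qed
  have "(\<Sum>m\<in>L. (a m - a' m) * Xi_tilde m (mset (word 0 bs))) = 0" if bs: "0 \<notin> set bs" for bs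
  proof -
    define X where "X m = Xi_tilde m (mset (word 0 bs))" for m
    have "(\<Sum>m\<in>L. a m * X m) = (\<Sum>m\<in>A. a m * X m)"
    proof (rule sum.mono_neutral_right [OF fin])
      show "\<forall>m\<in>L - A. a m * X m = 0" using part by (auto simp: A_def)
    qed (auto simp: L_def)
    also have "\<dots> = g (mset (word 0 bs))"
      by (simp add: fun_cong [OF gA] X_def)
    also have "\<dots> = (\<Sum>(d, S)\<in>B. b d S * X (set_type d S))"
      unfolding X_def
      by (rule symmetric_function_eq_sum_Xi_tilde [OF assms(1) gB _ bs]) (simp add: in_B)
    also have "\<dots> = (\<Sum>x\<in>B. b (fst x) (snd x) * X (shape x))"
      by (simp add: case_prod_unfold shape_def)
    also have "\<dots> = (\<Sum>m\<in>L. \<Sum>x\<in>{x \<in> B. shape x = m}. b (fst x) (snd x) * X (shape x))"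
      by (rule sum.group [OF B fin, symmetric]) (auto simp: L_def)
    also have "\<dots> = (\<Sum>m\<in>L. a' m * X m)"
      unfolding fiber [symmetric] sum_distrib_right case_prod_unfold
      by (intro sum.cong refl) simp
    finally show ?thesis by (simp add: left_diff_distrib sum_subtractf X_def)
  qed
  then have "a l - a' l = 0"
    by (intro Xi_tilde_independent [where L = L and c = "\<lambda>m. a m - a' m"] fin part)
      (simp_all add: L_def)
  then show "a l = (\<Sum>S | S \<subseteq> {1..<sum_list l} \<and> set_type (sum_list l) S = l. b (sum_list l) S)"
    unfolding a'_def by simp
qed

end
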